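(* Let the data $w_I^n$ be in hydrostatic equilibrium, i.e. for all $I\in\mathcal I$ $$\mathbf u_I=\mathbf 0,\qquad \rho_I=\alpha_I,\qquad p_I=\beta_I .$$ Then the first order scheme is well-balanced, i.e. one step of the scheme gives $w_I^{n+1}=w_I^n$ for all $I\in\mathcal I$.
   Context: **Equations.** The compressible Euler equations with gravity in $d$ space dimensions are $$\partial_t\rho+\nabla\cdot(\rho\mathbf u)=0,\quad \partial_t(\rho\mathbf u)+\nabla\cdot(\rho\mathbf u\otimes\mathbf u+\mathrm{Id}\,p)=-\rho\nabla\Phi,\quad \partial_tE+\nabla\cdot((E+p)\mathbf u)=-\rho\langle\mathbf u,\nabla\Phi\rangle,$$ with $E=\rho e+\tfrac12\rho\|\mathbf u\|^2$, a given potential $\Phi:\mathbb R^d\to\mathbb R$ and a general pressure law $p=p(\tau,e)$, $\tau=1/\rho$. Write $w=(\rho,\rho\mathbf u,E)$. The admissible set is $\Omega=\{w\in\mathbb R^{d+2}:\rho>0,\ e>0\}$; all data lie in $\Omega$. A hydrostatic equilibrium to be preserved is given by positive functions $\alpha,\beta$ on $\mathbb R^d$ with $\nabla\beta=-\alpha\nabla\Phi$ (it is the stationary solution $\mathbf u=0,\rho=\alpha,p=\beta$). **Mesh.** Uniform Cartesian mesh with step sizes $\Delta x_i>0$, $i=1,\dots,d$, cell centres $\mathbf x_I$, $I=(I_1,\dots,I_d)\in\mathcal I=\mathbb Z^d$; $I(i,k)$ denotes $I$ with $I_i$ replaced by $I_i+k$; $I(i,\pm\frac12)$ labels the interface between $C_I$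 and $C_{I(i,\pm1)}$. $w_I^n$ is the cell value at time $t^n$; $\alpha_I=\alpha(\mathbf x_I)$, $\beta_I=\beta(\mathbf x_I)$, $p_I=p(1/\rho_I,e_I)$. $\mathbf n_i$ is the $i$-th unit vector. **Interface solver in direction $i$.** Relaxation states are $W=(\rho,\rho\mathbf u,E,\rho\pi,\rho Z)$; the relaxation equilibrium state of a cell value $w_I$ is $W_I=(\rho_I,\rho_I\mathbf u_I,E_I,\rho_Ip_I,\rho_I\Phi(\mathbf x_I))$. Given left and right states $W_L,W_R$, a number $\overline S$ and a relaxation parameter $a>0$, let $u$ denote the $i$-th velocity component and define $$u^*=\tfrac12(u_L+u_R)-\tfrac1{2a}(\pi_R-\pi_L-\overline S),$$ $$\tfrac1{\rho_L^*}=\tfrac1{\rho_L}+\tfrac1a(u^*-u_L),\quad \tfrac1{\rho_R^*}=\tfrac1{\rho_R}+\tfrac1a(u_R-u^* ),\quad \pi_L^*=\pi_L+a(u_L-u^* ),\quad \pi_R^*=\pi_R+a(u^*-u_R),$$ $$e_{L}^*=e_{L}+\tfrac{(\pi_{L}^* )^2-\pi_{L}^2}{2a^2},\quad e_{R}^*=e_{R}+\tfrac{(\pi_{R}^* )^2-\pi_{R}^2}{2a^2},\quad Z_{L}^*=Z_{L},\quad Z_R^*=Z_R,$$ where the $i$-th velocity component of both $W_L^*$ and $W_R^*$ is $u^*$, the other velocity components are those of $W_L$, respectively $W_R$, and $E^*=\rho^*e^*+\frac12\rho^*\|\mathbf u^*\|^2$. The wave speeds are $\lambda^-=u_L-a/\rho_L$,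 $\lambda^{\mathbf u}=u^*$, $\lambda^+=u_R+a/\rho_R$, and $a$ is taken such that $\lambda^-<\lambda^{\mathbf u}<\lambda^+$. **Source discretization.** $$\overline S(W_L,W_R)=\Big(\tfrac{\rho_R}{\alpha_R}\beta_R-\tfrac{\rho_L}{\alpha_L}\beta_L\Big)-\tfrac12\Big(\tfrac{\rho_R}{\alpha_R}-\tfrac{\rho_L}{\alpha_L}\Big)(\beta_R+\beta_L),$$ where $\alpha_{L,R},\beta_{L,R}$ are the values of $\alpha,\beta$ at the centres of the left/right cell. **Numerical fluxes.** Let $F_{1,i}(W)=(\rho u_i,\ \rho u_i\mathbf u+\pi\mathbf n_i,\ u_i(E+\pi))\in\mathbb R^{d+2}$. At interface $I(i,\frac12)$ use $W_L=W_I$, $W_R=W_{I(i,1)}$, $\overline S=\overline S(W_I,W_{I(i,1)})$, $S=(0,\mathbf n_i\overline S,\lambda^{\mathbf u}\overline S)$, and set $$(F^-_{I(i,1/2)},F^+_{I(i,1/2)})=\begin{cases}(F_{1,i}(W_L),\,F_{1,i}(W_L)+S)&\lambda^-\ge0\\(F_{1,i}(W_L^* ),\,F_{1,i}(W_L^* )+S)&\lambda^{\mathbf u}>0>\lambda^-\\(F_{1,i}(W_L^* ),\,F_{1,i}(W_R^* ))&\lambda^{\mathbf u}=0\\(F_{1,i}(W_R^* )-S,\,F_{1,i}(W_R^* ))&\lambda^+>0>\lambda^{\mathbf u}\\(F_{1,i}(W_R)-S,\,F_{1,i}(W_R))&\lambda^+\le0.\end{cases}$$ **First order scheme.** With time step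 $\Delta t>0$, $$w_I^{n+1}=w_I^n-\Delta t\sum_{i=1}^d\frac1{\Delta x_i}\big(F^-_{I(i,1/2)}-F^+_{I(i,-1/2)}\big).$$ *)

theory Defs
  imports "HOL-Analysis.Analysis"
begin

text \<open>The finite type \<open>'d\<close> indexes the space directions (so $d$ is the number of its elements),
  and cells are indexed by \<open>int ^ 'd\<close>.\<close>

type_synonym 'd cons_state = "real \<times> (real, 'd) vec \<times> real"  \<comment> \<open>$(\rho, \rho u, E)$\<close>

definition mass_density :: "'d::finite cons_state \<Rightarrow> real" where
  "mass_density w = fst w"

definition momentum :: "'d::finite cons_state \<Rightarrow> real ^ 'd" where
  "momentum w = fst (snd w)"

definition total_energy :: "'d::finite cons_state \<Rightarrow> real" where
  "total_energy w = snd (snd w)"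

definition velocity :: "'d::finite cons_state \<Rightarrow> real ^ 'd" where
  "velocity w = momentum w /\<^sub>R mass_density w"

text \<open>Solves $E = \rho e + \frac12 \rho |u|^2$ for $e$.\<close>
definition internal_energy :: "'d::finite cons_state \<Rightarrow> real" where
  "internal_energy w = total_energy w / mass_density w - (norm (velocity w))\<^sup>2 / 2"

text \<open>The pressure law is a function of the specific volume and the internal energy.\<close>
definition pressure :: "(real \<Rightarrow> real \<Rightarrow> real) \<Rightarrow> 'd::finite cons_state \<Rightarrow> real" where
  "pressure p w = p (1 / mass_density w) (internal_energy w)"

definition admissible :: "'d::finite cons_state set" where
  "admissible = {w. mass_density w > 0 \<and> internal_energy w > 0}"

definition hydrostatic_profile ::
  "(real ^ 'd \<Rightarrow> real) \<Rightarrow> (real ^ 'd \<Rightarrow> real) \<Rightarrow> (real ^ 'd::finite \<Rightarrow> real) \<Rightarrow> bool" where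
  "hydrostatic_profile \<Phi> \<alpha> \<beta> \<longleftrightarrow>
     (\<forall>x. \<alpha> x > 0 \<and> \<beta> x > 0) \<and>
     (\<forall>x. \<exists>g. GDERIV \<Phi> x :> g \<and> GDERIV \<beta> x :> - (\<alpha> x *\<^sub>R g))"

text \<open>\<open>x0\<close> is the centre of the cell with index 0.\<close>
definition cell_centre :: "real ^ 'd \<Rightarrow> real ^ 'd \<Rightarrow> int ^ 'd::finite \<Rightarrow> real ^ 'd" where
  "cell_centre x0 \<Delta>x I = (\<chi> i. x0 $ i + of_int (I $ i) * \<Delta>x $ i)"

definition shift :: "int ^ 'd::finite \<Rightarrow> 'd \<Rightarrow> int \<Rightarrow> int ^ 'd" where
  "shift I i k = (\<chi> j. if j = i then I $ j + k else I $ j)"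

text \<open>\<open>rho_pi\<close> and \<open>rho_Z\<close> store the products $\rho\pi$ and $\rho Z$; \<open>rpi\<close> and \<open>rZ\<close> below recover $\pi$ and $Z$.\<close>
record ('d::finite) relax_state =
  rho :: real
  rho_u :: "real ^ 'd"
  Etot :: real
  rho_pi :: real
  rho_Z :: real

definition rvel :: "'d::finite relax_state \<Rightarrow> real ^ 'd" where
  "rvel W = rho_u W /\<^sub>R rho W"

definition rpi :: "'d::finite relax_state \<Rightarrow> real" where
  "rpi W = rho_pi W / rho W"

definition rZ :: "'d::finite relax_state \<Rightarrow> real" where
  "rZ W = rho_Z W / rho W"

definition rint :: "'d::finite relax_state \<Rightarrow> real" where
  "rint W = Etot W / rho W - (norm (rvel W))\<^sup>2 / 2"

definition of_primitive ::
  "real \<Rightarrow> real ^ 'd \<Rightarrow> real \<Rightarrow> real \<Rightarrow> real \<Rightarrow> 'd::finite relax_state" where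
  "of_primitive r u e q z =
     \<lparr>rho = r, rho_u = r *\<^sub>R u, Etot = r * e + r * (norm u)\<^sup>2 / 2, rho_pi = r * q, rho_Z = r * z\<rparr>"

definition relax_equilibrium ::
  "(real \<Rightarrow> real \<Rightarrow> real) \<Rightarrow> real \<Rightarrow> 'd::finite cons_state \<Rightarrow> 'd relax_state" where
  "relax_equilibrium p z w =
     \<lparr>rho = mass_density w, rho_u = momentum w, Etot = total_energy w,
      rho_pi = mass_density w * pressure p w, rho_Z = mass_density w * z\<rparr>"

definition u_star ::
  "'d \<Rightarrow> real \<Rightarrow> real \<Rightarrow> 'd::finite relax_state \<Rightarrow> 'd relax_state \<Rightarrow> real" where
  "u_star i a S WL WR =
     (rvel WL $ i + rvel WR $ i) / 2 - (rpi WR - rpi WL - S) / (2 * a)"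

definition speed_minus :: "'d \<Rightarrow> real \<Rightarrow> 'd::finite relax_state \<Rightarrow> real" where
  "speed_minus i a WL = rvel WL $ i - a / rho WL"

definition speed_plus :: "'d \<Rightarrow> real \<Rightarrow> 'd::finite relax_state \<Rightarrow> real" where
  "speed_plus i a WR = rvel WR $ i + a / rho WR"

definition replace_component :: "real ^ 'd \<Rightarrow> 'd \<Rightarrow> real \<Rightarrow> real ^ 'd::finite" where
  "replace_component v i c = (\<chi> j. if j = i then c else v $ j)"

definition left_star ::
  "'d \<Rightarrow> real \<Rightarrow> real \<Rightarrow> 'd::finite relax_state \<Rightarrow> 'd relax_state \<Rightarrow> 'd relax_state" where
  "left_star i a S WL WR =
     (let us = u_star i a S WL WR;
          \<tau>s = 1 / rho WL + (us - rvel WL $ i) / a;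
          \<pi>s = rpi WL + a * (rvel WL $ i - us);
          es = rint WL + (\<pi>s\<^sup>2 - (rpi WL)\<^sup>2) / (2 * a\<^sup>2)
      in of_primitive (1 / \<tau>s) (replace_component (rvel WL) i us) es \<pi>s (rZ WL))"

definition right_star ::
  "'d \<Rightarrow> real \<Rightarrow> real \<Rightarrow> 'd::finite relax_state \<Rightarrow> 'd relax_state \<Rightarrow> 'd relax_state" where
  "right_star i a S WL WR =
     (let us = u_star i a S WL WR;
          \<tau>s = 1 / rho WR + (rvel WR $ i - us) / a;
          \<pi>s = rpi WR + a * (us - rvel WR $ i);
          es = rint WR + (\<pi>s\<^sup>2 - (rpi WR)\<^sup>2) / (2 * a\<^sup>2)
      in of_primitive (1 / \<tau>s) (replace_component (rvel WR) i us) es \<pi>s (rZ WR))"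

definition source_disc ::
  "real \<Rightarrow> real \<Rightarrow> real \<Rightarrow> real \<Rightarrow> 'd::finite relax_state \<Rightarrow> 'd relax_state \<Rightarrow> real" where
  "source_disc \<alpha>L \<alpha>R \<beta>L \<beta>R WL WR =
     (rho WR / \<alpha>R * \<beta>R - rho WL / \<alpha>L * \<beta>L)
     - (rho WR / \<alpha>R - rho WL / \<alpha>L) * (\<beta>R + \<beta>L) / 2"

definition phys_flux :: "'d \<Rightarrow> 'd::finite relax_state \<Rightarrow> 'd cons_state" where
  "phys_flux i W =
     (rho W * rvel W $ i,
      (rho W * rvel W $ i) *\<^sub>R rvel W + rpi W *\<^sub>R axis i 1,
      rvel W $ i * (Etot W + rpi W))"

text \<open>The pair $(F^-, F^+)$. For ordered wave speeds the five cases are exclusive and exhaustive;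
  the final branch is the case \<open>speed_plus i a WR \<le> 0\<close>.\<close>
definition num_flux ::
  "'d \<Rightarrow> real \<Rightarrow> real \<Rightarrow> 'd::finite relax_state \<Rightarrow> 'd relax_state
    \<Rightarrow> 'd cons_state \<times> 'd cons_state" where
  "num_flux i a S WL WR =
     (let lm = speed_minus i a WL;
          lu = u_star i a S WL WR;
          lp = speed_plus i a WR;
          WLs = left_star i a S WL WR;
          WRs = right_star i a S WL WR;
          Sv = (0, S *\<^sub>R axis i 1, lu * S)
      in if lm \<ge> 0 then (phys_flux i WL, phys_flux i WL + Sv)
         else if lu > 0 \<and> 0 > lm then (phys_flux i WLs, phys_flux i WLs + Sv)
         else if lu = 0 then (phys_flux i WLs, phys_flux i WRs)
         else if lp > 0 \<and> 0 > lu then (phys_flux i WRs - Sv, phys_flux i WRs)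
         else (phys_flux i WR - Sv, phys_flux i WR))"

text \<open>Below, \<open>x\<close> maps a cell index to the cell centre, and the pair \<open>I\<close>, \<open>i\<close> stands for the interface
  between the cells \<open>I\<close> and \<open>shift I i 1\<close>.\<close>

definition cell_relax ::
  "(real \<Rightarrow> real \<Rightarrow> real) \<Rightarrow> (real ^ 'd \<Rightarrow> real) \<Rightarrow> (int ^ 'd \<Rightarrow> real ^ 'd)
    \<Rightarrow> (int ^ 'd \<Rightarrow> 'd cons_state) \<Rightarrow> int ^ 'd::finite \<Rightarrow> 'd relax_state" where
  "cell_relax p \<Phi> x w I = relax_equilibrium p (\<Phi> (x I)) (w I)"

definition interface_source ::
  "(real \<Rightarrow> real \<Rightarrow> real) \<Rightarrow> (real ^ 'd \<Rightarrow> real) \<Rightarrow> (real ^ 'd \<Rightarrow> real) \<Rightarrow> (real ^ 'd \<Rightarrow> real)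
    \<Rightarrow> (int ^ 'd \<Rightarrow> real ^ 'd) \<Rightarrow> (int ^ 'd \<Rightarrow> 'd cons_state) \<Rightarrow> int ^ 'd::finite \<Rightarrow> 'd \<Rightarrow> real" where
  "interface_source p \<Phi> \<alpha> \<beta> x w I i =
     source_disc (\<alpha> (x I)) (\<alpha> (x (shift I i 1))) (\<beta> (x I)) (\<beta> (x (shift I i 1)))
       (cell_relax p \<Phi> x w I) (cell_relax p \<Phi> x w (shift I i 1))"

text \<open>The relaxation parameter \<open>a\<close> may vary from interface to interface.\<close>
definition wave_ordering ::
  "(real \<Rightarrow> real \<Rightarrow> real) \<Rightarrow> (real ^ 'd \<Rightarrow> real) \<Rightarrow> (real ^ 'd \<Rightarrow> real) \<Rightarrow> (real ^ 'd \<Rightarrow> real)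
    \<Rightarrow> (int ^ 'd \<Rightarrow> real ^ 'd) \<Rightarrow> (int ^ 'd \<Rightarrow> 'd \<Rightarrow> real) \<Rightarrow> (int ^ 'd \<Rightarrow> 'd cons_state)
    \<Rightarrow> int ^ 'd::finite \<Rightarrow> 'd \<Rightarrow> bool" where
  "wave_ordering p \<Phi> \<alpha> \<beta> x a w I i \<longleftrightarrow>
     (let WL = cell_relax p \<Phi> x w I;
          WR = cell_relax p \<Phi> x w (shift I i 1);
          lu = u_star i (a I i) (interface_source p \<Phi> \<alpha> \<beta> x w I i) WL WR
      in speed_minus i (a I i) WL < lu \<and> lu < speed_plus i (a I i) WR)"

definition interface_flux ::
  "(real \<Rightarrow> real \<Rightarrow> real) \<Rightarrow> (real ^ 'd \<Rightarrow> real) \<Rightarrow> (real ^ 'd \<Rightarrow> real) \<Rightarrow> (real ^ 'd \<Rightarrow> real)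
    \<Rightarrow> (int ^ 'd \<Rightarrow> real ^ 'd) \<Rightarrow> (int ^ 'd \<Rightarrow> 'd \<Rightarrow> real) \<Rightarrow> (int ^ 'd \<Rightarrow> 'd cons_state)
    \<Rightarrow> int ^ 'd::finite \<Rightarrow> 'd \<Rightarrow> 'd cons_state \<times> 'd cons_state" where
  "interface_flux p \<Phi> \<alpha> \<beta> x a w I i =
     num_flux i (a I i) (interface_source p \<Phi> \<alpha> \<beta> x w I i)
       (cell_relax p \<Phi> x w I) (cell_relax p \<Phi> x w (shift I i 1))"

definition first_order_step ::
  "(real \<Rightarrow> real \<Rightarrow> real) \<Rightarrow> (real ^ 'd \<Rightarrow> real) \<Rightarrow> (real ^ 'd \<Rightarrow> real) \<Rightarrow> (real ^ 'd \<Rightarrow> real)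
    \<Rightarrow> real ^ 'd \<Rightarrow> real ^ 'd \<Rightarrow> (int ^ 'd \<Rightarrow> 'd \<Rightarrow> real) \<Rightarrow> real
    \<Rightarrow> (int ^ 'd \<Rightarrow> 'd cons_state) \<Rightarrow> int ^ 'd::finite \<Rightarrow> 'd cons_state" where
  "first_order_step p \<Phi> \<alpha> \<beta> x0 \<Delta>x a \<Delta>t w I =
     (let F = interface_flux p \<Phi> \<alpha> \<beta> (cell_centre x0 \<Delta>x) a w
      in w I - \<Delta>t *\<^sub>R (\<Sum>i\<in>UNIV. (1 / \<Delta>x $ i) *\<^sub>R (fst (F I i) - snd (F (shift I i (-1)) i))))"

definition discrete_hydrostatic ::
  "(real \<Rightarrow> real \<Rightarrow> real) \<Rightarrow> (real ^ 'd \<Rightarrow> real) \<Rightarrow> (real ^ 'd \<Rightarrow> real)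
    \<Rightarrow> (int ^ 'd \<Rightarrow> real ^ 'd) \<Rightarrow> (int ^ 'd::finite \<Rightarrow> 'd cons_state) \<Rightarrow> bool" where
  "discrete_hydrostatic p \<alpha> \<beta> x w \<longleftrightarrow>
     (\<forall>I. velocity (w I) = 0 \<and> mass_density (w I) = \<alpha> (x I) \<and> pressure p (w I) = \<beta> (x I))"

end

theory Submission
  imports Defs
begin

text \<open>
  The source discretization is built so that, for data with density \<open>\<alpha>\<close>, the ratios $\rho/\alpha$
  are 1, the averaged term drops out and $\overline S$ is exactly the jump of $\beta$, which for
  data in equilibrium is the jump of the pressure. In the formula for the intermediate velocity
  this source cancels the pressure jump, so both sides being at rest gives $u^* = 0$: the contact
  wave sits on the interface. With $u^* = 0$ the intermediate states coincide with the data, hence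
  the flux on each side of an interface consists of nothing but the pressure of the adjacent cell,
  acting on the normal momentum (\<open>num_flux_balanced_rest\<close>). The two fluxes that a cell receives in
  each direction then both carry its own pressure, and their difference vanishes.
\<close>

lemma shift_shift_inverse: "shift (shift I i (- 1)) i 1 = I"
  by (simp add: shift_def vec_eq_iff)

lemma phys_flux_at_rest:
  assumes "rvel W = 0"
  shows "phys_flux i W = (0, rpi W *\<^sub>R axis i 1, 0)"
  using assms by (simp add: phys_flux_def)

lemma u_star_balanced_rest:
  assumes "rvel WL = 0" "rvel WR = 0" "S = rpi WR - rpi WL"
  shows "u_star i a S WL WR = 0"
  using assms by (simp add: u_star_def)

text \<open>All corrections in the intermediate states are driven by the difference between the normal
  velocity of the data and $u^*$, so they vanish together with it.\<close>

lemma left_star_at_rest: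
  assumes "rvel WL = 0" "rho WL \<noteq> 0" "u_star i a S WL WR = 0"
  shows "left_star i a S WL WR = WL"
proof -
  have "replace_component 0 i 0 = (0 :: real ^ 'a)"
    by (simp add: replace_component_def vec_eq_iff)
  moreover have "rho_u WL = 0"
    using assms(1,2) by (simp add: rvel_def)
  ultimately show ?thesis
    using assms
    by (simp add: left_star_def Let_def of_primitive_def rint_def rpi_def rZ_def)
qed

lemma right_star_at_rest:
  assumes "rvel WR = 0" "rho WR \<noteq> 0" "u_star i a S WL WR = 0"
  shows "right_star i a S WL WR = WR"
proof -
  have "replace_component 0 i 0 = (0 :: real ^ 'a)"
    by (simp add: replace_component_def vec_eq_iff)
  moreover have "rho_u WR = 0"
    using assms(1,2) by (simp add: rvel_def)
  ultimately show ?thesis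
    using assms
    by (simp add: right_star_def Let_def of_primitive_def rint_def rpi_def rZ_def)
qed

text \<open>The solver is in its third case: the acoustic wave to the left has speed $-a/\rho_L < 0$ and
  the contact is stationary. The source then needs no separate contribution, since it is already
  accounted for by the pressure jump between the two fluxes.\<close>

lemma num_flux_balanced_rest:
  assumes rest: "rvel WL = 0" "rvel WR = 0"
    and rho: "rho WL > 0" "rho WR > 0"
    and "a > 0"
    and balance: "S = rpi WR - rpi WL"
  shows "num_flux i a S WL WR
    = ((0, rpi WL *\<^sub>R axis i 1, 0), (0, rpi WR *\<^sub>R axis i 1, 0))"
proof -
  have us: "u_star i a S WL WR = 0"
    by (rule u_star_balanced_rest[OF rest balance])
  have "speed_minus i a WL < 0"
    using rest rho \<open>a > 0\<close> by (simp add: speed_minus_def)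
  moreover have "left_star i a S WL WR = WL"
    using rho by (intro left_star_at_rest rest us) simp
  moreover have "right_star i a S WL WR = WR"
    using rho by (intro right_star_at_rest rest us) simp
  ultimately show ?thesis
    using us rest by (simp add: num_flux_def phys_flux_at_rest)
qed

lemma source_disc_hydrostatic:
  assumes "rho WL = \<alpha>L" "rho WR = \<alpha>R" "\<alpha>L \<noteq> 0" "\<alpha>R \<noteq> 0"
  shows "source_disc \<alpha>L \<alpha>R \<beta>L \<beta>R WL WR = \<beta>R - \<beta>L"
  using assms by (simp add: source_disc_def)

lemma interface_flux_hydrostatic:
  assumes hydro: "discrete_hydrostatic p \<alpha> \<beta> x w"
    and pos: "\<And>y. \<alpha> y > 0"
    and "a I i > 0"
  shows "interface_flux p \<Phi> \<alpha> \<beta> x a w I i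
    = ((0, \<beta> (x I) *\<^sub>R axis i 1, 0), (0, \<beta> (x (shift I i 1)) *\<^sub>R axis i 1, 0))"
proof -
  let ?W = "cell_relax p \<Phi> x w"
  have rho: "rho (?W J) = \<alpha> (x J)" for J
    using hydro by (simp add: discrete_hydrostatic_def cell_relax_def relax_equilibrium_def)
  have "rvel (?W J) = velocity (w J)" for J
    by (simp add: cell_relax_def relax_equilibrium_def rvel_def velocity_def)
  then have rest: "rvel (?W J) = 0" for J
    using hydro by (simp add: discrete_hydrostatic_def)
  have pi: "rpi (?W J) = \<beta> (x J)" for J
    using hydro pos[of "x J"]
    by (simp add: discrete_hydrostatic_def cell_relax_def relax_equilibrium_def rpi_def)
  have "\<alpha> y \<noteq> 0" for y
    using pos[of y] by simp
  then have "interface_source p \<Phi> \<alpha> \<beta> x w I i = \<beta> (x (shift I i 1)) - \<beta> (x I)"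
    by (simp add: interface_source_def source_disc_hydrostatic rho)
  then show ?thesis
    using \<open>a I i > 0\<close> pos
    by (simp add: interface_flux_def num_flux_balanced_rest rest rho pi)
qed

theorem theorem8:
  fixes p :: "real \<Rightarrow> real \<Rightarrow> real"
    and \<Phi> \<alpha> \<beta> :: "real ^ 'd::finite \<Rightarrow> real"
    and x0 \<Delta>x :: "real ^ 'd"
    and a :: "int ^ 'd \<Rightarrow> 'd \<Rightarrow> real"
    and \<Delta>t :: real
    and w :: "int ^ 'd \<Rightarrow> 'd cons_state"
  assumes "hydrostatic_profile \<Phi> \<alpha> \<beta>"
    and "\<forall>i. \<Delta>x $ i > 0"
    and "\<Delta>t > 0"
    and "\<forall>I. w I \<in> admissible"
    and "\<forall>I i. a I i > 0"
    and "\<forall>I i. wave_ordering p \<Phi> \<alpha> \<beta> (cell_centre x0 \<Delta>x) a w I i"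
    and "discrete_hydrostatic p \<alpha> \<beta> (cell_centre x0 \<Delta>x) w"
  shows "\<forall>I. first_order_step p \<Phi> \<alpha> \<beta> x0 \<Delta>x a \<Delta>t w I = w I"
proof
  fix I
  have pos: "\<alpha> y > 0" for y
    using assms(1) by (simp add: hydrostatic_profile_def)
  note flux = interface_flux_hydrostatic[where a = a, OF assms(7) pos assms(5)[rule_format]]
  show "first_order_step p \<Phi> \<alpha> \<beta> x0 \<Delta>x a \<Delta>t w I = w I"
    by (simp add: first_order_step_def flux shift_shift_inverse flip: zero_prod_def)
qed

end
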